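(* Let $\sigma_X>0$, $a_Y>0$ and $\theta_Y>0$. Let $X$ be a Gaussian random variable with mean $0$ and standard deviation $\sigma_X$, let $Y$ be a Pareto distributed random variable with parameters $a_Y$ and $\theta_Y$, and assume that $X$ and $Y$ are independent. Then the random variable $Z=XY$ has the probability density function $$f_Z(z)=\frac{a_Y\theta_Y^{a_Y}\sigma_X^{a_Y}}{\sqrt{2\pi}\,|z|^{a_Y+1}}\,2^{(a_Y-1)/2}\,\gamma\left(\frac{a_Y+1}{2},\frac{z^2}{2\sigma_X^2\theta_Y^2}\right),\qquad z\in\mathbb{R},\ z\neq 0.$$
   Context: A real random variable has the Pareto distribution with parameters $a,\theta>0$ if it has the probability density function (with respect to Lebesgue measure) $f(y)=a\theta^{a}/y^{a+1}$ for $y>\theta$, and $f(y)=0$ otherwise. The function $\gamma(\cdot,\cdot)$ is the incomplete Gamma function defined by $\gamma(\alpha,x)=\int_0^x t^{\alpha-1}\exp\{-t\}\,dt$ for $\alpha>0$, $x\ge 0$. *)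

theory Defs
  imports "HOL-Probability.Probability"
begin

definition pareto_density :: "real \<Rightarrow> real \<Rightarrow> real \<Rightarrow> real" where
  "pareto_density a \<theta> y = (if y > \<theta> then a * \<theta> powr a / y powr (a + 1) else 0)"

text \<open>
  Lower incomplete Gamma function, meant for \<open>\<alpha> > 0\<close> and \<open>x \<ge> 0\<close>. For \<open>\<alpha> \<le> 1\<close> the convention
  \<open>0 powr _ = 0\<close> changes the integrand only at the endpoint \<open>t = 0\<close>.
\<close>
definition lower_incomplete_Gamma :: "real \<Rightarrow> real \<Rightarrow> real" where
  "lower_incomplete_Gamma \<alpha> x = (LBINT t:{0..x}. t powr (\<alpha> - 1) * exp (- t))"

end

theory Submission
  imports Defs
begin

text \<open>
  The product of independent random variables with densities \<open>f\<close> and \<open>g\<close> has the density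
  \<open>z \<mapsto> \<integral> f (z / y) g y / \<bar>y\<bar> dy\<close>. For a Gaussian \<open>f\<close> and a Pareto \<open>g\<close> the integrand is, up to a
  constant, \<open>exp (- c / y\<^sup>2) / y powr (a + 2)\<close> on \<open>y > \<theta>\<close> with \<open>c = z\<^sup>2 / (2 \<sigma>\<^sup>2)\<close>, and the
  substitution \<open>t = c / y\<^sup>2\<close> turns the integral into an incomplete Gamma function.
\<close>

lemma lower_incomplete_Gamma_nonneg: "0 \<le> lower_incomplete_Gamma \<alpha> x"
  unfolding lower_incomplete_Gamma_def set_lebesgue_integral_def
  by (intro integral_nonneg_AE) (simp add: indicator_def)

text \<open>The claimed density must be measurable in z. With the domain of integration turned into
  a condition on the pair of x and t, the integrand is jointly measurable and the integral
  measurable in its parameter x.\<close>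

lemma borel_measurable_lower_incomplete_Gamma [measurable]:
  "lower_incomplete_Gamma \<alpha> \<in> borel_measurable borel"
proof -
  have "lower_incomplete_Gamma \<alpha> =
      (\<lambda>x. LBINT t. (if 0 \<le> t \<and> t \<le> x then t powr (\<alpha> - 1) * exp (- t) else 0))"
    unfolding lower_incomplete_Gamma_def set_lebesgue_integral_def
    by (intro ext Bochner_Integration.integral_cong) (auto simp: indicator_def)
  then show ?thesis
    by simp
qed

text \<open>As exp (- t) is at most 1, the integrand is dominated by \<open>t powr (p - 1)\<close>,
  whose singularity at 0 is integrable because p - 1 > -1.\<close>

lemma absolutely_integrable_lower_incomplete_Gamma:
  fixes p T :: real
  assumes "p > 0" "T \<ge> 0"
  shows "(\<lambda>t. t powr (p - 1) * exp (- t)) absolutely_integrable_on {0..T}"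
proof (rule measurable_bounded_by_integrable_imp_absolutely_integrable)
  show "(\<lambda>t. t powr (p - 1) * exp (- t)) \<in> borel_measurable (lebesgue_on {0..T})"
    by (intro measurable_restrict_space1 measurable_completion) simp
  show "(\<lambda>t. t powr (p - 1)) integrable_on {0..T}"
    using has_integral_powr_from_0[of "p - 1" T] assms by (auto simp: integrable_on_def)
qed (auto intro!: mult_left_le)

text \<open>The exponent \<open>2 * p + 1\<close> is the one that fits t = c / y^2: the Jacobian 2c
  / y^3 times t^(p - 1) = c^(p - 1) y^(2 - 2p) is 2 c^p / y^(2p + 1).\<close>

lemma nn_integral_exp_inverse_square:
  fixes c p \<theta> :: real
  assumes c: "c > 0" and p: "p > 0" and \<theta>: "\<theta> > 0"
  shows "(\<integral>\<^sup>+y\<in>{\<theta><..}. ennreal (exp (- c / y\<^sup>2) / y powr (2 * p + 1)) \<partial>lborel) =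
    ennreal (lower_incomplete_Gamma p (c / \<theta>\<^sup>2) / (2 * c powr p))"
proof -
  define F where "F t = t powr (p - 1) * exp (- t)" for t :: real
  define g where "g y = c / y\<^sup>2" for y :: real
  define h where "h y = exp (- c / y\<^sup>2) / y powr (2 * p + 1)" for y :: real
  have [measurable]: "F \<in> borel_measurable borel" "h \<in> borel_measurable borel"
    unfolding F_def h_def by measurable
  have der: "(g has_field_derivative - 2 * c / y ^ 3) (at y within {\<theta><..})"
    if "y \<in> {\<theta><..}" for y
    unfolding g_def using that \<theta>
    by (auto intro!: derivative_eq_intros simp: field_simps power2_eq_square power3_eq_cube)
  have inj: "inj_on g {\<theta><..}"
    using c \<theta> by (auto simp: inj_on_def g_def)
  have img: "g ` {\<theta><..} = {0<..<c / \<theta>\<^sup>2}"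
  proof (intro equalityI subsetI)
    fix t assume "t \<in> g ` {\<theta><..}"
    then show "t \<in> {0<..<c / \<theta>\<^sup>2}"
      using c \<theta> by (auto simp: g_def intro!: divide_strict_left_mono power_strict_mono)
  next
    fix t assume t: "t \<in> {0<..<c / \<theta>\<^sup>2}"
    have "\<theta>\<^sup>2 < c / t"
      using t c \<theta> by (simp add: field_simps)
    then have "\<theta> < sqrt (c / t)"
      by (rule real_less_rsqrt)
    moreover have "g (sqrt (c / t)) = t"
      using t c by (simp add: g_def)
    ultimately show "t \<in> g ` {\<theta><..}"
      by (metis greaterThan_iff image_eqI)
  qed
  have eq: "\<bar>- 2 * c / y ^ 3\<bar> * F (g y) = 2 * c powr p * h y" if "y \<in> {\<theta><..}" for y
  proof -
    have y: "y > 0" using that \<theta> by simp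
    have "(c / y\<^sup>2) powr (p - 1) = (c powr p / c) / (y powr (2 * p) / y\<^sup>2)"
      using y c by (simp add: powr_divide powr_diff powr_powr flip: powr_numeral)
    moreover have "y powr (2 * p + 1) = y powr (2 * p) * y"
      using y by (simp add: powr_add)
    ultimately show ?thesis
      using y c by (simp add: F_def g_def h_def abs_mult field_simps power2_eq_square power3_eq_cube)
  qed
  have I: "F absolutely_integrable_on {0..c / \<theta>\<^sup>2}"
    unfolding F_def using p c by (intro absolutely_integrable_lower_incomplete_Gamma) auto
  have "integral {0..c / \<theta>\<^sup>2} F = lower_incomplete_Gamma p (c / \<theta>\<^sup>2)"
  proof -
    \<comment> \<open>The change of variables works with gauge integrals and
      \<open>lebesgue\<close>, the completion of \<open>lborel\<close>; for the Borel function
      \<open>F\<close> the completion does not alter the integral.\<close>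
    have "lower_incomplete_Gamma p (c / \<theta>\<^sup>2) = (LINT t:{0..c / \<theta>\<^sup>2}|lebesgue. F t)"
      unfolding lower_incomplete_Gamma_def F_def set_lebesgue_integral_def
      by (subst integral_completion) auto
    then show ?thesis
      using I by (simp add: set_lebesgue_integral_eq_integral)
  qed
  \<comment> \<open>The image of \<open>g\<close> lacks both endpoints, which do not affect the
    integral.\<close>
  moreover have "F absolutely_integrable_on {0<..<c / \<theta>\<^sup>2}"
    by (rule set_integrable_subset[OF I]) auto
  \<comment> \<open>The rule is an equivalence that transfers integrability and value together,
    hence the conjunction.\<close>
  ultimately have "(\<lambda>y. \<bar>- 2 * c / y ^ 3\<bar> * F (g y)) absolutely_integrable_on {\<theta><..} \<and>
      integral {\<theta><..} (\<lambda>y. \<bar>- 2 * c / y ^ 3\<bar> * F (g y)) = lower_incomplete_Gamma p (c / \<theta>\<^sup>2)"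
    by (subst has_absolute_integral_change_of_variables_1'[OF _ der inj])
       (auto simp: img integral_open_interval_real)
  also have "(\<lambda>y. \<bar>- 2 * c / y ^ 3\<bar> * F (g y)) absolutely_integrable_on {\<theta><..} \<longleftrightarrow>
      (\<lambda>y. 2 * c powr p * h y) absolutely_integrable_on {\<theta><..}"
    by (rule set_integrable_cong[OF refl refl eq])
  also have "integral {\<theta><..} (\<lambda>y. \<bar>- 2 * c / y ^ 3\<bar> * F (g y)) =
      integral {\<theta><..} (\<lambda>y. 2 * c powr p * h y)"
    by (rule Henstock_Kurzweil_Integration.integral_cong[OF eq])
  finally have 1: "(\<lambda>y. 2 * c powr p * h y) absolutely_integrable_on {\<theta><..}"
    and 2: "integral {\<theta><..} (\<lambda>y. 2 * c powr p * h y) = lower_incomplete_Gamma p (c / \<theta>\<^sup>2)"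
    by auto
  have 3: "h absolutely_integrable_on {\<theta><..}"
    using 1 c by simp
  have 4: "integral {\<theta><..} h = lower_incomplete_Gamma p (c / \<theta>\<^sup>2) / (2 * c powr p)"
    using 2 c by (simp add: field_simps)
  \<comment> \<open>Since \<open>h\<close> is nonnegative and absolutely integrable, its gauge,
    Lebesgue and nonnegative integrals agree.\<close>
  have "(\<integral>\<^sup>+y\<in>{\<theta><..}. ennreal (h y) \<partial>lborel) =
      (\<integral>\<^sup>+y. ennreal (indicator {\<theta><..} y * h y) \<partial>lebesgue)"
    by (simp add: nn_integral_completion) (auto intro!: nn_integral_cong simp: indicator_def)
  also have "\<dots> = ennreal (LINT y:{\<theta><..}|lebesgue. h y)"
    using 3 unfolding set_lebesgue_integral_def set_integrable_def
    by (subst nn_integral_eq_integral) (auto simp: h_def)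
  also have "\<dots> = ennreal (lower_incomplete_Gamma p (c / \<theta>\<^sup>2) / (2 * c powr p))"
    using 3 4 by (simp add: set_lebesgue_integral_eq_integral)
  finally show ?thesis
    by (simp add: h_def)
qed

text \<open>For fixed nonzero y, scaling x to z = x y gives the factor 1 / \<bar>y\<bar>; Tonelli
  then makes z the outer variable. Densities in \<open>ennreal\<close> spare all integrability
  conditions.\<close>

lemma (in prob_space) distributed_mult_indep:
  fixes X Y :: "'a \<Rightarrow> real"
  assumes X: "distributed M lborel X f" and Y: "distributed M lborel Y g"
    and indep: "indep_var borel X borel Y"
  shows "distributed M lborel (\<lambda>\<omega>. X \<omega> * Y \<omega>)
    (\<lambda>z. \<integral>\<^sup>+y. f (z / y) * g y * ennreal (1 / \<bar>y\<bar>) \<partial>lborel)"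
  unfolding distributed_def
proof (intro conjI)
  have f[measurable]: "f \<in> borel_measurable borel" and g[measurable]: "g \<in> borel_measurable borel"
    and XM[measurable]: "X \<in> borel_measurable M" and YM[measurable]: "Y \<in> borel_measurable M"
    using X Y by (auto simp: distributed_def)
  \<comment> \<open>Composing with \<open>id\<close> only changes the target spaces from
    \<open>borel\<close> to \<open>lborel\<close>, as the joint density rule demands.\<close>
  have "indep_var lborel (id \<circ> X) lborel (id \<circ> Y)"
    using indep by (rule indep_var_compose) auto
  then have XY: "distributed M (lborel \<Otimes>\<^sub>M lborel) (\<lambda>\<omega>. (X \<omega>, Y \<omega>)) (\<lambda>(x, y). f x * g y)"
    by (intro distributed_joint_indep X Y sigma_finite_lborel) simp
  show m: "(\<lambda>z. \<integral>\<^sup>+y. f (z / y) * g y * ennreal (1 / \<bar>y\<bar>) \<partial>lborel) \<in> borel_measurable lborel"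
    by measurable
  show "(\<lambda>\<omega>. X \<omega> * Y \<omega>) \<in> measurable M lborel"
    by simp
  show "distr M lborel (\<lambda>\<omega>. X \<omega> * Y \<omega>) =
    density lborel (\<lambda>z. \<integral>\<^sup>+y. f (z / y) * g y * ennreal (1 / \<bar>y\<bar>) \<partial>lborel)"
  proof (rule measure_eqI)
    fix A assume "A \<in> sets (distr M lborel (\<lambda>\<omega>. X \<omega> * Y \<omega>))"
    then have A[measurable]: "A \<in> sets borel" by simp
    have scale: "(\<integral>\<^sup>+x. f x * indicator A (x * y) \<partial>lborel) =
        (\<integral>\<^sup>+z. f (z / y) * ennreal (1 / \<bar>y\<bar>) * indicator A z \<partial>lborel)" if "y \<noteq> 0" for y
    proof -
      \<comment> \<open>The affine substitution rule is used with shift 0 and slope 1 / y.\<close>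
      have "(\<integral>\<^sup>+x. f x * indicator A (x * y) \<partial>lborel) =
          ennreal \<bar>1 / y\<bar> * (\<integral>\<^sup>+z. f (0 + 1 / y * z) * indicator A ((0 + 1 / y * z) * y) \<partial>lborel)"
        using that by (intro nn_integral_real_affine) auto
      then show ?thesis
        using that by (simp add: nn_integral_cmult[symmetric] ac_simps)
    qed
    have "emeasure (distr M lborel (\<lambda>\<omega>. X \<omega> * Y \<omega>)) A =
        (\<integral>\<^sup>+\<omega>. (case (X \<omega>, Y \<omega>) of (x, y) \<Rightarrow> indicator A (x * y)) \<partial>M)"
      by (simp add: nn_integral_indicator[symmetric] nn_integral_distr del: nn_integral_indicator)
    also have "\<dots> = (\<integral>\<^sup>+(x, y). f x * g y * indicator A (x * y) \<partial>(lborel \<Otimes>\<^sub>M lborel))"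
      by (subst distributed_nn_integral[OF XY, symmetric])
        (auto simp: case_prod_beta intro!: nn_integral_cong)
    also have "\<dots> = (\<integral>\<^sup>+y. (\<integral>\<^sup>+x. f x * g y * indicator A (x * y) \<partial>lborel) \<partial>lborel)"
      by (subst lborel_pair.nn_integral_snd[symmetric]) (auto simp: case_prod_beta)
    also have "\<dots> = (\<integral>\<^sup>+y. g y * (\<integral>\<^sup>+x. f x * indicator A (x * y) \<partial>lborel) \<partial>lborel)"
      by (simp add: nn_integral_cmult[symmetric] ac_simps)
    \<comment> \<open>Scaling fails only at y = 0, a null set.\<close>
    also have "\<dots> = (\<integral>\<^sup>+y. g y * (\<integral>\<^sup>+z. f (z / y) * ennreal (1 / \<bar>y\<bar>) * indicator A z \<partial>lborel) \<partial>lborel)"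
      using AE_lborel_singleton[of 0] by (intro nn_integral_cong_AE) (auto simp: scale)
    also have "\<dots> = (\<integral>\<^sup>+y. (\<integral>\<^sup>+z. f (z / y) * g y * ennreal (1 / \<bar>y\<bar>) * indicator A z \<partial>lborel) \<partial>lborel)"
      by (simp add: nn_integral_cmult[symmetric] ac_simps)
    also have "\<dots> = (\<integral>\<^sup>+z. (\<integral>\<^sup>+y. f (z / y) * g y * ennreal (1 / \<bar>y\<bar>) * indicator A z \<partial>lborel) \<partial>lborel)"
      by (intro lborel_pair.Fubini') measurable
    also have "\<dots> = (\<integral>\<^sup>+z. (\<integral>\<^sup>+y. f (z / y) * g y * ennreal (1 / \<bar>y\<bar>) \<partial>lborel) * indicator A z \<partial>lborel)"
      by (simp add: nn_integral_multc)
    also have "\<dots> = emeasure (density lborel (\<lambda>z. \<integral>\<^sup>+y. f (z / y) * g y * ennreal (1 / \<bar>y\<bar>) \<partial>lborel)) A"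
      using m by (simp add: emeasure_density)
    finally show "emeasure (distr M lborel (\<lambda>\<omega>. X \<omega> * Y \<omega>)) A = \<dots>" .
  qed simp
qed

theorem lemma2:
  fixes M :: "'a measure" and X Y :: "'a \<Rightarrow> real"
    and \<sigma>\<^sub>X a\<^sub>Y \<theta>\<^sub>Y :: real
  assumes "prob_space M"
    and "\<sigma>\<^sub>X > 0" and "a\<^sub>Y > 0" and "\<theta>\<^sub>Y > 0"
    and "distributed M lborel X (\<lambda>x. ennreal (normal_density 0 \<sigma>\<^sub>X x))"
    and "distributed M lborel Y (\<lambda>y. ennreal (pareto_density a\<^sub>Y \<theta>\<^sub>Y y))"
    and "prob_space.indep_var M borel X borel Y"
  shows "distributed M lborel (\<lambda>\<omega>. X \<omega> * Y \<omega>)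
    (\<lambda>z. ennreal
      (a\<^sub>Y * \<theta>\<^sub>Y powr a\<^sub>Y * \<sigma>\<^sub>X powr a\<^sub>Y / (sqrt (2 * pi) * \<bar>z\<bar> powr (a\<^sub>Y + 1))
        * 2 powr ((a\<^sub>Y - 1) / 2)
        * lower_incomplete_Gamma ((a\<^sub>Y + 1) / 2) (z\<^sup>2 / (2 * \<sigma>\<^sub>X\<^sup>2 * \<theta>\<^sub>Y\<^sup>2))))"
    (is "distributed _ _ _ ?h")
proof -
  interpret prob_space M by fact
  let ?f = "\<lambda>z. \<integral>\<^sup>+y. ennreal (normal_density 0 \<sigma>\<^sub>X (z / y)) * ennreal (pareto_density a\<^sub>Y \<theta>\<^sub>Y y)
      * ennreal (1 / \<bar>y\<bar>) \<partial>lborel"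
  have D: "distributed M lborel (\<lambda>\<omega>. X \<omega> * Y \<omega>) ?f"
    by (rule distributed_mult_indep) fact+
  \<comment> \<open>At z = 0 the two sides differ: division by zero makes \<open>?h\<close> vanish
    there, while \<open>?f\<close> is positive. Equality almost everywhere is enough for a
    density.\<close>
  have "?f z = ?h z" if "z \<noteq> 0" for z
  proof -
    \<comment> \<open>The Gaussian exponent at z / y is - c / y^2. The power of y is a + 1 from the
      Pareto density plus 1 from the factor 1 / \<bar>y\<bar>, so \<open>2 * p + 1\<close> must be a
      + 2. \<open>K\<close> collects the constants of both densities.\<close>
    define c where "c = z\<^sup>2 / (2 * \<sigma>\<^sub>X\<^sup>2)"
    define p where "p = (a\<^sub>Y + 1) / 2"
    define K where "K = a\<^sub>Y * \<theta>\<^sub>Y powr a\<^sub>Y / (sqrt (2 * pi) * \<sigma>\<^sub>X)"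
    have c: "c > 0" and p: "p > 0" and K: "K \<ge> 0"
      using assms that by (auto simp: c_def p_def K_def)
    have pt: "normal_density 0 \<sigma>\<^sub>X (z / y) * pareto_density a\<^sub>Y \<theta>\<^sub>Y y * (1 / \<bar>y\<bar>) =
        K * (exp (- c / y\<^sup>2) / y powr (2 * p + 1)) * indicator {\<theta>\<^sub>Y<..} y" for y
    proof (cases "y > \<theta>\<^sub>Y")
      case True
      then have y: "y > 0" using assms by simp
      have "y powr (2 * p + 1) = y powr (a\<^sub>Y + 1) * y"
        using y powr_add[of y "a\<^sub>Y + 1" 1] by (simp add: p_def add_divide_distrib)
      moreover have "- (z / y)\<^sup>2 / (2 * \<sigma>\<^sub>X\<^sup>2) = - c / y\<^sup>2"
        by (simp add: c_def power_divide)
      ultimately show ?thesis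
        using True y \<open>\<sigma>\<^sub>X > 0\<close> by (simp add: normal_density_def pareto_density_def K_def
            real_sqrt_mult ac_simps)
    qed (simp add: pareto_density_def)
    have "?f z = (\<integral>\<^sup>+y. ennreal K * (ennreal (exp (- c / y\<^sup>2) / y powr (2 * p + 1))
        * indicator {\<theta>\<^sub>Y<..} y) \<partial>lborel)"
    proof (rule nn_integral_cong)
      fix y
      have "0 \<le> pareto_density a\<^sub>Y \<theta>\<^sub>Y y"
        using assms by (simp add: pareto_density_def)
      then have "ennreal (normal_density 0 \<sigma>\<^sub>X (z / y)) * ennreal (pareto_density a\<^sub>Y \<theta>\<^sub>Y y)
          * ennreal (1 / \<bar>y\<bar>) =
          ennreal (K * (exp (- c / y\<^sup>2) / y powr (2 * p + 1)) * indicator {\<theta>\<^sub>Y<..} y)"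
        by (subst pt[symmetric]) (simp add: ennreal_mult del: times_divide_eq_right)
      also have "\<dots> = ennreal K * (ennreal (exp (- c / y\<^sup>2) / y powr (2 * p + 1))
          * indicator {\<theta>\<^sub>Y<..} y)"
        using K by (simp add: indicator_def ennreal_mult del: times_divide_eq_right)
      finally show "ennreal (normal_density 0 \<sigma>\<^sub>X (z / y)) * ennreal (pareto_density a\<^sub>Y \<theta>\<^sub>Y y)
          * ennreal (1 / \<bar>y\<bar>) = \<dots>" .
    qed
    also have "\<dots> = ennreal K * ennreal (lower_incomplete_Gamma p (c / \<theta>\<^sub>Y\<^sup>2) / (2 * c powr p))"
      using nn_integral_exp_inverse_square[OF c p \<open>\<theta>\<^sub>Y > 0\<close>] by (simp add: nn_integral_cmult)
    also have "\<dots> = ennreal (K * (lower_incomplete_Gamma p (c / \<theta>\<^sub>Y\<^sup>2) / (2 * c powr p)))"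
      using K by (simp add: ennreal_mult lower_incomplete_Gamma_nonneg del: times_divide_eq_right)
    \<comment> \<open>Dividing by c^p brings in \<sigma>^(a + 1), of which one factor cancels
      against \<open>K\<close>, and 2^p, which the 2 in the denominator reduces to 2^((a - 1) /
      2).\<close>
    also have "K * (lower_incomplete_Gamma p (c / \<theta>\<^sub>Y\<^sup>2) / (2 * c powr p)) =
        a\<^sub>Y * \<theta>\<^sub>Y powr a\<^sub>Y * \<sigma>\<^sub>X powr a\<^sub>Y / (sqrt (2 * pi) * \<bar>z\<bar> powr (a\<^sub>Y + 1))
        * 2 powr ((a\<^sub>Y - 1) / 2) * lower_incomplete_Gamma p (c / \<theta>\<^sub>Y\<^sup>2)"
    proof -
      have sq: "(x\<^sup>2) powr p = x powr (a\<^sub>Y + 1)" if "x > 0" for x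
        using that by (simp add: p_def powr_powr add_divide_distrib flip: powr_numeral)
      have "c powr p = \<bar>z\<bar> powr (a\<^sub>Y + 1) / (2 powr p * \<sigma>\<^sub>X powr (a\<^sub>Y + 1))"
        using sq[of "\<bar>z\<bar>"] sq[of \<sigma>\<^sub>X] assms that by (simp add: c_def powr_divide powr_mult)
      moreover have "2 powr p = 2 * 2 powr ((a\<^sub>Y - 1) / 2)"
      proof -
        have "p = 1 + (a\<^sub>Y - 1) / 2"
          by (simp add: p_def field_simps)
        then show ?thesis
          by (simp only: powr_add) simp
      qed
      moreover have "\<sigma>\<^sub>X powr (a\<^sub>Y + 1) = \<sigma>\<^sub>X powr a\<^sub>Y * \<sigma>\<^sub>X"
        using assms by (simp add: powr_add)
      ultimately show ?thesis
        using assms by (simp add: K_def)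
    qed
    finally show ?thesis
      by (simp add: c_def p_def)
  qed
  then have "AE z in lborel. ?f z = ?h z"
    using AE_lborel_singleton[of 0] by auto
  moreover have "?f \<in> borel_measurable lborel"
    using D by (rule distributed_borel_measurable)
  ultimately show ?thesis
    using D by (subst distributed_cong_density[symmetric]) auto
qed

end
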